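(* Let $a<b$ be real numbers, let $X=C([a,b])$ be the space of real continuous functions with the norm $\|\cdot\|_\infty$, and let $g\in X$. Let $K\colon[a,b]\times[a,b]\to\mathbb R$ be measurable with $$M:=\sup_{t\in[a,b]}\int_a^t|K(t,s)|\,ds<\infty .$$ Let $f\colon[a,b]\times\mathbb R\to\mathbb R$ be continuous in the second variable, satisfy $|f(s,u)-f(s,v)|\le L_f|u-v|$ for all $s\in[a,b]$, $u,v\in\mathbb R$, with a constant $L_f\ge0$, and satisfy $M_{f_0}:=\sup_{s\in[a,b]}|f(s,0)|<\infty$. Let $T\colon X\to X$ be given by $$(Tx)(t):=g(t)+\int_a^tK(t,s)\,f(s,x(s))\,ds ,\qquad t\in[a,b].$$ Assume $L:=L_fM<1$ and put $$R:=\frac{\|g\|_\infty+M\,M_{f_0}}{1-L},\qquad C:=\{x\in X:\|x\|_\infty\le R\}.$$ Then the Volterra equation $$x(t)=g(t)+\int_a^tK(t,s)\,f(s,x(s))\,ds,\qquad t\in[a,b],$$ has a unique solution $x^\ast\in C$, and for any $x_0\in C$ the Picard iterates $x_{n+1}:=Tx_n$ satisfy, for all $n\in\mathbb N$, $$\|x_n-x^\ast\|_\infty\le\frac{L^{n}}{1-L}\,\delta_0,\qquad \delta_0:=\|Tx_0-x_0\|_\infty .$$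
   Context: The displayed formula is assumed to define a map $T\colon X\to X$: for every $x\in X$ and $t\in[a,b]$ the function $s\mapsto K(t,s)f(s,x(s))$ is integrable on $[a,t]$, and $Tx$ is continuous. $\mathbb N=\{0,1,2,\dots\}$. *)

theory Defs
  imports "HOL-Analysis.Analysis"
begin

text \<open>
  The space \<open>C([a,b])\<close>. Its elements are normalised to \<^const>\<open>undefined\<close> outside \<open>[a,b]\<close>,
  so that HOL equality is equality of functions on \<open>[a,b]\<close>.
\<close>
definition cont_space :: "real \<Rightarrow> real \<Rightarrow> (real \<Rightarrow> real) set" where
  "cont_space a b = {x \<in> extensional {a..b}. continuous_on {a..b} x}"

definition sup_norm :: "real \<Rightarrow> real \<Rightarrow> (real \<Rightarrow> real) \<Rightarrow> real" where
  "sup_norm a b x = (SUP t\<in>{a..b}. \<bar>x t\<bar>)"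

text \<open>
  The Volterra integral is a Lebesgue (Bochner) integral; it takes the junk value \<open>0\<close> if the
  integrand is not integrable, so integrability has to be assumed separately.
\<close>
definition volterra_op ::
  "real \<Rightarrow> real \<Rightarrow> (real \<Rightarrow> real) \<Rightarrow> (real \<Rightarrow> real \<Rightarrow> real) \<Rightarrow> (real \<Rightarrow> real \<Rightarrow> real)
    \<Rightarrow> (real \<Rightarrow> real) \<Rightarrow> (real \<Rightarrow> real)" where
  "volterra_op a b g K f x =
    (\<lambda>t\<in>{a..b}. g t + (LINT s:{a..t}|lebesgue. K t s * f s (x s)))"

text \<open>
  The supremum of \<open>\<integral>\<^sub>a\<^sup>t |K(t,s)| ds\<close> over \<open>t \<in> [a,b]\<close> as an extended
  nonnegative number, so that its finiteness is a genuine condition.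
\<close>
definition kernel_bound :: "real \<Rightarrow> real \<Rightarrow> (real \<Rightarrow> real \<Rightarrow> real) \<Rightarrow> ennreal" where
  "kernel_bound a b K = (SUP t\<in>{a..b}. \<integral>\<^sup>+s\<in>{a..t}. ennreal \<bar>K t s\<bar> \<partial>lebesgue)"

end

theory Submission
  imports Defs
begin

text \<open>
  The Lipschitz bound on \<open>f\<close> makes \<open>T\<close> an \<open>L\<close>-contraction of all of \<open>C([a,b])\<close>, so Banach's
  theorem gives a unique fixed point \<open>x\<^sup>*\<close> there. It lies in \<open>C\<close> because
  \<open>\<parallel>Tx\<parallel> \<le> \<parallel>g\<parallel> + M (L\<^sub>f \<parallel>x\<parallel> + M\<^sub>f\<^sub>0)\<close> can be solved for \<open>\<parallel>x\<^sup>*\<parallel>\<close>, since \<open>L < 1\<close>. The error estimate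
  combines \<open>\<parallel>x\<^sub>n - x\<^sup>*\<parallel> \<le> L\<^sup>n \<parallel>x\<^sub>0 - x\<^sup>*\<parallel>\<close> with \<open>(1 - L) \<parallel>x\<^sub>0 - x\<^sup>*\<parallel> \<le> \<parallel>Tx\<^sub>0 - x\<^sub>0\<parallel>\<close>.
\<close>

text \<open>The factor \<open>1 / (1 - k)\<close> comes from one triangle inequality through
  \<open>f x\<close>, with \<open>p = f p\<close>; no geometric series is summed.\<close>

lemma (in Metric_space) contraction_a_priori_bound:
  assumes f: "f \<in> M \<rightarrow> M" and k: "0 \<le> k" "k < 1"
    and con: "\<And>x y. \<lbrakk>x \<in> M; y \<in> M\<rbrakk> \<Longrightarrow> d (f x) (f y) \<le> k * d x y"
    and p: "p \<in> M" "f p = p" and x: "x \<in> M"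
  shows "d ((f ^^ n) x) p \<le> k ^ n / (1 - k) * d (f x) x"
proof -
  \<comment> \<open>Membership is carried through the induction because \<open>con\<close> speaks
    only about points of \<open>M\<close>.\<close>
  have iter: "(f ^^ n) x \<in> M \<and> d ((f ^^ n) x) p \<le> k ^ n * d x p" for n
  proof (induction n)
    case 0
    show ?case using x by simp
  next
    case (Suc n)
    then have M: "(f ^^ n) x \<in> M" and le: "d ((f ^^ n) x) p \<le> k ^ n * d x p" by auto
    have "d (f ((f ^^ n) x)) p \<le> k * d ((f ^^ n) x) p"
      using con[OF M p(1)] p(2) by simp
    also have "\<dots> \<le> k * (k ^ n * d x p)"
      using le k(1) by (rule mult_left_mono)
    finally show ?case using f M by auto
  qed
  have fx: "f x \<in> M" using f x by auto
  have "d x p \<le> d x (f x) + d (f x) p"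
    using triangle[OF x fx p(1)] .
  also have "\<dots> \<le> d (f x) x + k * d x p"
    using con[OF x p(1)] p(2) by (simp add: commute)
  finally have "d x p \<le> d (f x) x / (1 - k)"
    using k(2) by (simp add: field_simps)
  then have "k ^ n * d x p \<le> k ^ n * (d (f x) x / (1 - k))"
    using k(1) by (intro mult_left_mono) auto
  then show ?thesis using iter[of n] by simp
qed

lemma sup_norm_le:
  assumes "a \<le> b" "\<And>t. t \<in> {a..b} \<Longrightarrow> \<bar>x t\<bar> \<le> B"
  shows "sup_norm a b x \<le> B"
  unfolding sup_norm_def using assms by (intro cSUP_least) auto

text \<open>Compactness makes the image bounded above; for an unbounded set a real
  \<open>SUP\<close> need not be an upper bound.\<close>

lemma abs_le_sup_norm:
  assumes "continuous_on {a..b} x" "t \<in> {a..b}"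
  shows "\<bar>x t\<bar> \<le> sup_norm a b x"
  unfolding sup_norm_def
proof (rule cSUP_upper[OF assms(2)])
  have "compact ((\<lambda>t. \<bar>x t\<bar>) ` {a..b})"
    by (intro compact_continuous_image continuous_on_rabs assms(1)) simp
  then show "bdd_above ((\<lambda>t. \<bar>x t\<bar>) ` {a..b})"
    by (intro bounded_imp_bdd_above compact_imp_bounded)
qed

text \<open>On the compact interval the boundedness built into \<open>cfunspace\<close> is
  automatic, and both sides use the same \<open>extensional\<close> normalisation.\<close>

lemma mspace_cfunspace_cont_space:
  "mspace (cfunspace (top_of_set {a..b}) (euclidean_metric :: real metric)) = cont_space a b"
  by (subst compactin_mspace_cfunspace) (auto simp: cont_space_def)

lemma mdist_cfunspace_sup_norm:
  assumes "x \<in> cont_space a b" "y \<in> cont_space a b" "a \<le> b"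
  shows "mdist (cfunspace (top_of_set {a..b}) (euclidean_metric :: real metric)) x y
    = sup_norm a b (\<lambda>t. x t - y t)" (is "mdist ?m x y = ?s")
proof (rule order.antisym)
  \<comment> \<open>This equivalence makes the distance the least uniform bound on
    \<open>\<bar>x t - y t\<bar>\<close>. It is used below with \<open>r\<close> the supremum norm
    and with \<open>r\<close> the distance itself.\<close>
  have le: "mdist ?m x y \<le> r \<longleftrightarrow> (\<forall>t\<in>{a..b}. \<bar>x t - y t\<bar> \<le> r)" for r
    using cfunspace_mdist_le[of x "top_of_set {a..b}" euclidean_metric y r] assms
    unfolding mspace_cfunspace_cont_space by (simp add: dist_real_def)
  show "mdist ?m x y \<le> ?s"
    unfolding le using assms
    by (auto intro!: abs_le_sup_norm[of a b "\<lambda>t. x t - y t"] continuous_intros simp: cont_space_def)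
  show "?s \<le> mdist ?m x y"
    using le[of "mdist ?m x y"] assms(3) by (intro sup_norm_le) auto
qed

lemma mcomplete_of_cfunspace_real:
  "mcomplete_of (cfunspace (top_of_set {a..b}) (euclidean_metric :: real metric))"
proof -
  have "Metric_space.mcomplete (UNIV :: real set) dist"
    by (simp add: mcomplete_iff_complete complete_UNIV)
  from Met_TC.mcomplete_cfunspace[OF this] show ?thesis
    unfolding Met_TC.Self_def euclidean_metric_def .
qed

text \<open>Integrability of the product is a separate hypothesis: \<open>h\<close> is not assumed
  measurable, so its bound alone would not give it.\<close>

lemma abs_set_integral_mult_le:
  fixes k h :: "'a \<Rightarrow> real"
  assumes "set_integrable M A k" "set_integrable M A (\<lambda>s. k s * h s)"
    and "\<And>s. s \<in> A \<Longrightarrow> \<bar>h s\<bar> \<le> B"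
  shows "\<bar>LINT s:A|M. k s * h s\<bar> \<le> (LINT s:A|M. \<bar>k s\<bar>) * B"
proof -
  have "\<bar>LINT s:A|M. k s * h s\<bar> \<le> (LINT s:A|M. \<bar>k s * h s\<bar>)"
    using set_integral_norm_bound[OF assms(2)] by simp
  also have "\<dots> \<le> (LINT s:A|M. \<bar>k s\<bar> * B)"
  proof (rule set_integral_mono)
    show "set_integrable M A (\<lambda>s. \<bar>k s\<bar> * B)"
      using assms(1) by (cases "B = 0") (auto simp: set_integrable_def[of _ _ "\<lambda>_. 0"] set_integrable_abs)
      show "set_integrable M A (\<lambda>s. \<bar>k s * h s\<bar>)"
      by (rule set_integrable_abs[OF assms(2)])
  qed (use assms(3) in \<open>auto intro: mult_left_mono simp: abs_mult\<close>)
  finally show ?thesis by simp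
qed

text \<open>Finiteness of the extended supremum makes every slice integrable, so its extended
  integral is a real Lebesgue integral. Finiteness also matters for the last bound, since
  \<open>enn2real\<close> sends infinity to 0.\<close>

lemma kernel_bound_slice:
  assumes meas: "set_borel_measurable lebesgue {a..t} (K t)"
    and fin: "kernel_bound a b K < \<infinity>" and t: "t \<in> {a..b}"
  shows "set_integrable lebesgue {a..t} (K t)"
    and "(LINT s:{a..t}|lebesgue. \<bar>K t s\<bar>) \<le> enn2real (kernel_bound a b K)"
proof -
  let ?N = "\<integral>\<^sup>+s. ennreal (norm (indicator {a..t} s *\<^sub>R K t s)) \<partial>lebesgue"
  have "?N = (\<integral>\<^sup>+s\<in>{a..t}. ennreal \<bar>K t s\<bar> \<partial>lebesgue)"
    by (intro nn_integral_cong) (auto split: split_indicator)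
  also have "\<dots> \<le> kernel_bound a b K"
    unfolding kernel_bound_def using t by (rule SUP_upper)
  finally have le: "?N \<le> kernel_bound a b K" .
  then have "?N < \<infinity>" using fin by (rule le_less_trans)
  with meas show int: "set_integrable lebesgue {a..t} (K t)"
    unfolding set_integrable_def set_borel_measurable_def by (rule integrableI_bounded)
  have "?N = ennreal (\<integral>s. norm (indicator {a..t} s *\<^sub>R K t s) \<partial>lebesgue)"
    using int unfolding set_integrable_def by (intro nn_integral_eq_integral integrable_norm) auto
  also have "(\<integral>s. norm (indicator {a..t} s *\<^sub>R K t s) \<partial>lebesgue) = (LINT s:{a..t}|lebesgue. \<bar>K t s\<bar>)"
    unfolding set_lebesgue_integral_def by (simp add: abs_mult)
  finally have "ennreal (LINT s:{a..t}|lebesgue. \<bar>K t s\<bar>) \<le> kernel_bound a b K"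
    using le by simp
  moreover have "0 \<le> (LINT s:{a..t}|lebesgue. \<bar>K t s\<bar>)"
    unfolding set_lebesgue_integral_def by (intro integral_nonneg_AE) auto
  ultimately show "(LINT s:{a..t}|lebesgue. \<bar>K t s\<bar>) \<le> enn2real (kernel_bound a b K)"
    using fin enn2real_mono[of "ennreal (LINT s:{a..t}|lebesgue. \<bar>K t s\<bar>)" "kernel_bound a b K"] by simp
qed

theorem theorem8p7:
  fixes a b M L\<^sub>f M\<^sub>f\<^sub>0 L R :: real
    and g :: "real \<Rightarrow> real"
    and K f :: "real \<Rightarrow> real \<Rightarrow> real"
    and T :: "(real \<Rightarrow> real) \<Rightarrow> (real \<Rightarrow> real)"
    and X C :: "(real \<Rightarrow> real) set"
  assumes "a < b"
    and X_def: "X = cont_space a b"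
    and "g \<in> X"
    and "set_borel_measurable lebesgue ({a..b} \<times> {a..b}) (\<lambda>(t, s). K t s)"
    and "\<And>t. t \<in> {a..b} \<Longrightarrow> set_borel_measurable lebesgue {a..t} (K t)"
    and "kernel_bound a b K < \<infinity>"
    and M_def: "M = enn2real (kernel_bound a b K)"
    and "\<And>s. s \<in> {a..b} \<Longrightarrow> continuous_on UNIV (f s)"
    and "0 \<le> L\<^sub>f"
    and "\<And>s u v. s \<in> {a..b} \<Longrightarrow> \<bar>f s u - f s v\<bar> \<le> L\<^sub>f * \<bar>u - v\<bar>"
    and "bdd_above ((\<lambda>s. \<bar>f s 0\<bar>) ` {a..b})"
    and Mf0_def: "M\<^sub>f\<^sub>0 = (SUP s\<in>{a..b}. \<bar>f s 0\<bar>)"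
    and T_def: "T = volterra_op a b g K f"
    and "\<And>x t. x \<in> X \<Longrightarrow> t \<in> {a..b} \<Longrightarrow>
           set_integrable lebesgue {a..t} (\<lambda>s. K t s * f s (x s))"
    and "T \<in> X \<rightarrow> X"
    and L_def: "L = L\<^sub>f * M"
    and "L < 1"
    and R_def: "R = (sup_norm a b g + M * M\<^sub>f\<^sub>0) / (1 - L)"
    and C_def: "C = {x \<in> X. sup_norm a b x \<le> R}"
  shows "\<exists>xs. xs \<in> C
    \<and> (\<forall>t\<in>{a..b}. xs t = g t + (LINT s:{a..t}|lebesgue. K t s * f s (xs s)))
    \<and> (\<forall>y\<in>C. (\<forall>t\<in>{a..b}. y t = g t + (LINT s:{a..t}|lebesgue. K t s * f s (y s)))
         \<longrightarrow> y = xs)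
    \<and> (\<forall>x\<^sub>0\<in>C. \<forall>n. sup_norm a b (\<lambda>t. (T ^^ n) x\<^sub>0 t - xs t)
         \<le> L ^ n / (1 - L) * sup_norm a b (\<lambda>t. T x\<^sub>0 t - x\<^sub>0 t))"
proof -
  note K_meas = assms(5) and K_fin = assms(6) and f_lip = assms(10) and f0_bdd = assms(11)
    and Kf_int = assms(14) and T_into = assms(15)
  define m where "m = cfunspace (top_of_set {a..b}) (euclidean_metric :: real metric)"
  have ab: "a \<le> b" using \<open>a < b\<close> by simp
  have ms: "mspace m = X"
    unfolding m_def X_def by (rule mspace_cfunspace_cont_space)
  have md: "mdist m x y = sup_norm a b (\<lambda>t. x t - y t)" if "x \<in> X" "y \<in> X" for x y
    using that ab unfolding m_def X_def by (intro mdist_cfunspace_sup_norm)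
  have cont: "continuous_on {a..b} x" if "x \<in> X" for x
    using that by (simp add: X_def cont_space_def)
  have M0: "0 \<le> M" unfolding M_def by simp
  have L0: "0 \<le> L" unfolding L_def using \<open>0 \<le> L\<^sub>f\<close> M0 by simp
  have T_eq: "T x t = g t + (LINT s:{a..t}|lebesgue. K t s * f s (x s))" if "t \<in> {a..b}" for x t
    using that by (simp add: T_def volterra_op_def)
  \<comment> \<open>This estimate serves twice: with \<open>h\<close> a difference of values of
    \<open>f\<close> for the contraction, and with \<open>h s = f s (p s)\<close> for the bound on
    the fixed point.\<close>
  have K_le: "\<bar>LINT s:{a..t}|lebesgue. K t s * h s\<bar> \<le> M * B"
    if t: "t \<in> {a..b}" and h: "set_integrable lebesgue {a..t} (\<lambda>s. K t s * h s)"
      and B: "\<And>s. s \<in> {a..t} \<Longrightarrow> \<bar>h s\<bar> \<le> B" for t h B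
  proof -
    note slice = kernel_bound_slice[of a t K b, OF K_meas[OF t] K_fin t]
    \<comment> \<open>The point \<open>a\<close> lies in \<open>{a..t}\<close>, so \<open>B\<close>
      dominates an absolute value.\<close>
    have "0 \<le> B" using B[of a] t by fastforce
    then show ?thesis
      using abs_set_integral_mult_le[OF slice(1) h B] mult_right_mono[OF slice(2)]
      unfolding M_def by fastforce
  qed
  have contr: "mdist m (T x) (T y) \<le> L * mdist m x y" if x: "x \<in> X" and y: "y \<in> X" for x y
  proof -
    let ?r = "sup_norm a b (\<lambda>t. x t - y t)"
    have "\<bar>T x t - T y t\<bar> \<le> L * ?r" if t: "t \<in> {a..b}" for t
    proof -
      \<comment> \<open>The fold factors out \<open>K t s\<close>, leaving one integral of the
        kernel against a difference of values of \<open>f\<close>.\<close>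
      note diff = set_integral_diff[OF Kf_int[OF x t] Kf_int[OF y t], folded right_diff_distrib]
      have "\<bar>f s (x s) - f s (y s)\<bar> \<le> L\<^sub>f * ?r" if "s \<in> {a..t}" for s
      proof -
        have s: "s \<in> {a..b}" using that t by auto
        have "\<bar>x s - y s\<bar> \<le> ?r"
          using abs_le_sup_norm[of a b "\<lambda>t. x t - y t" s] s x y
          by (auto intro: continuous_intros cont)
        then show ?thesis
          using f_lip[OF s, of "x s" "y s"] mult_left_mono[OF _ \<open>0 \<le> L\<^sub>f\<close>] by fastforce
      qed
      from K_le[OF t diff(1) this] show ?thesis
        by (simp add: T_eq[OF t] diff(2) L_def ac_simps)
    qed
    then have "sup_norm a b (\<lambda>t. T x t - T y t) \<le> L * ?r"
      by (intro sup_norm_le ab)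
    then show ?thesis using x y T_into by (auto simp: md Pi_iff)
  qed
  interpret Metric_space X "mdist m"
    using Metric_space_mspace_mdist[of m] unfolding ms .
  have "mcomplete"
    using mcomplete_of_cfunspace_real[of a b, folded m_def] by (simp add: mcomplete_of_def ms)
  \<comment> \<open>Here \<open>g\<close> serves only to show that \<open>X\<close> is
    nonempty.\<close>
  then obtain p where p: "p \<in> X" "T p = p"
    using Banach_fixedpoint_thm[OF _ _ T_into \<open>L < 1\<close> contr] \<open>g \<in> X\<close> by auto
  have "sup_norm a b p \<le> sup_norm a b g + M * (L\<^sub>f * sup_norm a b p + M\<^sub>f\<^sub>0)"
  proof (rule sup_norm_le[OF ab])
    fix t assume t: "t \<in> {a..b}"
    \<comment> \<open>Comparing with the value at 0 turns the Lipschitz condition into linear growth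
      of \<open>f\<close>.\<close>
    have "\<bar>f s (p s)\<bar> \<le> L\<^sub>f * sup_norm a b p + M\<^sub>f\<^sub>0" if "s \<in> {a..t}" for s
    proof -
      have s: "s \<in> {a..b}" using that t by auto
      have "\<bar>f s 0\<bar> \<le> M\<^sub>f\<^sub>0"
        unfolding Mf0_def using f0_bdd by (intro cSUP_upper s)
      moreover have "L\<^sub>f * \<bar>p s\<bar> \<le> L\<^sub>f * sup_norm a b p"
        using abs_le_sup_norm[OF cont[OF p(1)] s] \<open>0 \<le> L\<^sub>f\<close> by (rule mult_left_mono)
      ultimately show ?thesis using f_lip[OF s, of "p s" 0] by simp
    qed
    from K_le[OF t Kf_int[OF p(1) t] this]
    show "\<bar>p t\<bar> \<le> sup_norm a b g + M * (L\<^sub>f * sup_norm a b p + M\<^sub>f\<^sub>0)"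
      using T_eq[OF t, of p] p(2) abs_le_sup_norm[OF cont[OF \<open>g \<in> X\<close>] t] by simp
  qed
  \<comment> \<open>\<open>R\<close> is the solution of
    \<open>r = sup_norm a b g + M * (L\<^sub>f * r + M\<^sub>f\<^sub>0)\<close>.\<close>
  then have "sup_norm a b p \<le> R"
    using \<open>L < 1\<close> unfolding R_def L_def by (simp add: field_simps)
  with p(1) have "p \<in> C" by (simp add: C_def)
  moreover have "\<forall>t\<in>{a..b}. p t = g t + (LINT s:{a..t}|lebesgue. K t s * f s (p s))"
    using T_eq[of _ p] p(2) by simp
  moreover have "y = p"
    if y: "y \<in> C" and eq: "\<forall>t\<in>{a..b}. y t = g t + (LINT s:{a..t}|lebesgue. K t s * f s (y s))" for y
  proof -
    have yX: "y \<in> X" using y by (simp add: C_def)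
    \<comment> \<open>The equation constrains \<open>y\<close> only on \<open>[a,b]\<close>;
      equality as HOL functions follows because both sides are \<open>extensional\<close>.\<close>
    have "T y = y"
    proof (rule extensionalityI)
      show "T y \<in> extensional {a..b}" by (simp add: T_def volterra_op_def)
      show "y \<in> extensional {a..b}" using yX by (simp add: X_def cont_space_def)
    qed (use T_eq eq in simp)
    then show ?thesis
      using contraction_imp_unique_fixpoint[OF _ p(2) T_into \<open>L < 1\<close> contr yX p(1)] by simp
  qed
  moreover have "sup_norm a b (\<lambda>t. (T ^^ n) x\<^sub>0 t - p t)
      \<le> L ^ n / (1 - L) * sup_norm a b (\<lambda>t. T x\<^sub>0 t - x\<^sub>0 t)" if "x\<^sub>0 \<in> C" for x\<^sub>0 n
  proof -
    have x: "x\<^sub>0 \<in> X" using that by (simp add: C_def)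
    \<comment> \<open>\<open>md\<close> reads the metric as a supremum norm only for members of
      \<open>X\<close>.\<close>
    have Tn: "(T ^^ n) x\<^sub>0 \<in> X" by (induction n) (use x T_into in auto)
    have Tx: "T x\<^sub>0 \<in> X" using x T_into by auto
    show ?thesis
      using contraction_a_priori_bound[OF T_into L0 \<open>L < 1\<close> contr p x, of n]
      unfolding md[OF Tn p(1)] md[OF Tx x] .
  qed
  ultimately show ?thesis by blast
qed

end
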